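(* Let $\Omega_i=\mathbb{R}^{m_i}$, $i=1,2,3$. Suppose that $W^{2d}$ is convex and locally strictly convex at $(u^{1d},u^{2d},u^{3d})$, that $J_2$ is Fréchet differentiable at $(u^{1d},u^{2d},u^{3d})$, and that $\nabla_{u^1}J_2(u^{1d},u^{2d},u^{3d})\ne 0$. Suppose moreover that, for the leader's affine strategy $\gamma^{1*}$ (an affine map $\Omega_2\times\Omega_3\to\Omega_1$ with $\gamma^{1*}(u^{2d},u^{3d})=u^{1d}$ whose graph lies on the supporting hyperplane $\Pi_{W^{2d}}$) used to define $\bar J_3$ and $\bar W^{3d}$, the set $\bar W^{3d}$ is convex and locally strictly convex at $(u^{2d},u^{3d})$, $\bar J_3$ is Fréchet differentiable at $(u^{2d},u^{3d})$, and $\nabla_{u^2}\bar J_3(u^{2d},u^{3d})\neq 0$. Then there exist optimal reverse Stackelberg strategies $\gamma^{1*}$ of the leader and $\gamma^{2*}$ of the middle level player that guarantee the achievement of the equilibrium solution $(u^{1d},u^{2d},u^{3d})$.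
   Context: Trilevel static game: the leader, the middle level player and the follower choose $u^1\in\Omega_1$, $u^2\in\Omega_2$, $u^3\in\Omega_3$ respectively, where $\Omega_i=\mathbb{R}^{m_i}$, $m_i\ge 1$, and minimize cost functions $J_1,J_2,J_3:\Omega_1\times\Omega_2\times\Omega_3\to\mathbb{R}$ respectively. $J_1$ is assumed to have a unique global minimizer $(u^{1d},u^{2d},u^{3d})$, called the desired equilibrium. $W^{2d}=\{(u^1,u^2,u^3): J_2(u^1,u^2,u^3)\le J_2(u^{1d},u^{2d},u^{3d})\}$. Its supporting hyperplane $\Pi_{W^{2d}}$ at $(u^{1d},u^{2d},u^{3d})$ is $$\sum_{i=1}^3\langle\nabla_{u^i}J_2(u^{1d},u^{2d},u^{3d}),u^i-u^{id}\rangle=0.$$ For a fixed leader's strategy $\gamma^{1*}$, $\bar J_3(u^2,u^3)=J_3(\gamma^{1*}(u^2,u^3),u^2,u^3)$ and $\bar W^{3d}=\{(u^2,u^3)\in\Omega_2\times\Omega_3:\bar J_3(u^2,u^3)\le\bar J_3(u^{2d},u^{3d})\}$. Affine maps $\gamma^{1*}:\Omega_2\times\Omega_3\to\Omega_1$ and $\gamma^{2*}:\Omega_3\to\Omega_2$ are optimal reverse Stackelberg strategies achieving the equilibrium $(u^{1d},u^{2d},u^{3d})$ if: $\gamma^{1*}(u^{2d},u^{3d})=u^{1d}$; $\gamma^{2*}(u^{3d})=u^{2d}$; $(u^{2d},u^{3d})$ is the unique minimizer of $(u^2,u^3)\mapsto J_2(\gamma^{1*}(u^2,u^3),u^2,u^3)$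 over $\Omega_2\times\Omega_3$; and $u^{3d}$ is the unique minimizer of $u^3\mapsto J_3(\gamma^{1*}(\gamma^{2*}(u^3),u^3),\gamma^{2*}(u^3),u^3)$ over $\Omega_3$. A set $W$ is locally strictly convex at a point $x\in W$ if $x$ is a boundary point of $W$ and there is a neighbourhood $U$ of $x$ such that for every $y\in W\cap U$, $y\ne x$, the open segment between $x$ and $y$ lies in the interior of $W$. *)

theory Defs
  imports "HOL-Analysis.Analysis"
begin

definition unique_minimizer :: "('a \<Rightarrow> real) \<Rightarrow> 'a \<Rightarrow> bool" where
  "unique_minimizer f x \<longleftrightarrow>
     is_arg_min f (\<lambda>_. True) x \<and> (\<forall>y. is_arg_min f (\<lambda>_. True) y \<longrightarrow> y = x)"

definition sublevel_set :: "('a \<Rightarrow> real) \<Rightarrow> 'a \<Rightarrow> 'a set" where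
  "sublevel_set f x = {y. f y \<le> f x}"

definition locally_strictly_convex_at :: "'a::euclidean_space set \<Rightarrow> 'a \<Rightarrow> bool" where
  "locally_strictly_convex_at W x \<longleftrightarrow>
     x \<in> W \<and> x \<in> frontier W \<and>
     (\<exists>U. open U \<and> x \<in> U \<and>
        (\<forall>y\<in>W \<inter> U. y \<noteq> x \<longrightarrow> open_segment x y \<subseteq> interior W))"

definition affine_map :: "('a::real_vector \<Rightarrow> 'b::real_vector) \<Rightarrow> bool" where
  "affine_map f \<longleftrightarrow> (\<exists>L c. linear L \<and> (\<forall>x. f x = L x + c))"

(* The value is meaningful only where f is differentiable. *)
definition gradient :: "('a::euclidean_space \<Rightarrow> real) \<Rightarrow> 'a \<Rightarrow> 'a" where
  "gradient f x = (THE D. GDERIV f x :> D)"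

text \<open>The spaces \<open>\<Omega>\<^sub>i = \<real>\<^bsup>m\<^sub>i\<^esup>\<close> are the types \<open>real ^ 'm\<^sub>i\<close>. The partial gradient of a cost with
  respect to one player's variable is the gradient in that variable with the others frozen.\<close>

definition supporting_hyperplane ::
    "((real ^ 'm1) \<times> (real ^ 'm2) \<times> (real ^ 'm3) \<Rightarrow> real) \<Rightarrow>
     real ^ 'm1 \<Rightarrow> real ^ 'm2 \<Rightarrow> real ^ 'm3 \<Rightarrow>
     ((real ^ 'm1) \<times> (real ^ 'm2) \<times> (real ^ 'm3)) set" where
  "supporting_hyperplane J u1d u2d u3d =
     {(u1, u2, u3).
        gradient (\<lambda>v. J (v, u2d, u3d)) u1d \<bullet> (u1 - u1d)
      + gradient (\<lambda>v. J (u1d, v, u3d)) u2d \<bullet> (u2 - u2d)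
      + gradient (\<lambda>v. J (u1d, u2d, v)) u3d \<bullet> (u3 - u3d) = 0}"

definition induced_cost ::
    "((real ^ 'm1) \<times> (real ^ 'm2) \<times> (real ^ 'm3) \<Rightarrow> real) \<Rightarrow>
     ((real ^ 'm2) \<times> (real ^ 'm3) \<Rightarrow> real ^ 'm1) \<Rightarrow>
     (real ^ 'm2) \<times> (real ^ 'm3) \<Rightarrow> real" where
  "induced_cost J \<gamma>1 = (\<lambda>(u2, u3). J (\<gamma>1 (u2, u3), u2, u3))"

definition optimal_reverse_stackelberg ::
    "((real ^ 'm1) \<times> (real ^ 'm2) \<times> (real ^ 'm3) \<Rightarrow> real) \<Rightarrow>
     ((real ^ 'm1) \<times> (real ^ 'm2) \<times> (real ^ 'm3) \<Rightarrow> real) \<Rightarrow>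
     real ^ 'm1 \<Rightarrow> real ^ 'm2 \<Rightarrow> real ^ 'm3 \<Rightarrow>
     ((real ^ 'm2) \<times> (real ^ 'm3) \<Rightarrow> real ^ 'm1) \<Rightarrow>
     (real ^ 'm3 \<Rightarrow> real ^ 'm2) \<Rightarrow> bool" where
  "optimal_reverse_stackelberg J2 J3 u1d u2d u3d \<gamma>1 \<gamma>2 \<longleftrightarrow>
     affine_map \<gamma>1 \<and> affine_map \<gamma>2 \<and>
     \<gamma>1 (u2d, u3d) = u1d \<and> \<gamma>2 u3d = u2d \<and>
     unique_minimizer (\<lambda>(u2, u3). J2 (\<gamma>1 (u2, u3), u2, u3)) (u2d, u3d) \<and>
     unique_minimizer (\<lambda>u3. J3 (\<gamma>1 (\<gamma>2 u3, u3), \<gamma>2 u3, u3)) u3d"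

end

theory Submission
  imports Defs
begin

text \<open>A tangent direction cannot stay in a sublevel set \<open>W\<close> that is locally strictly convex at
  \<open>x\<close>: by convexity it would enter the interior of \<open>W\<close> along the tangent hyperplane, and moving
  from there a little in a direction of ascent would give a point \<open>w \<in> W\<close> with \<open>D (w - x) > 0\<close>, although
  the whole segment from \<open>x\<close> to \<open>w\<close> lies in \<open>W\<close>. Hence \<open>x\<close> is the unique minimizer on its tangent
  hyperplane. This is applied to \<open>J\<^sub>2\<close> on the graph of the leader's strategy, and then to the induced cost of
  the follower on the graph of a middle level strategy lying in the tangent hyperplane.\<close>

text \<open>If \<open>D (w - x)\<close> were positive, \<open>f\<close> would exceed
  \<open>f x\<close> just after leaving \<open>x\<close> towards \<open>w\<close>, but convexity
  keeps that segment inside the sublevel set.\<close>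

lemma derivative_nonpos_on_convex_sublevel:
  fixes f :: "'a::real_normed_vector \<Rightarrow> real"
  assumes D: "(f has_derivative D) (at x)"
    and W: "convex (sublevel_set f x)" "w \<in> sublevel_set f x"
  shows "D (w - x) \<le> 0"
proof (rule ccontr)
  assume "\<not> D (w - x) \<le> 0"
  then have pos: "D (w - x) > 0" by simp
  define g where "g t = f (x + t *\<^sub>R (w - x))" for t :: real
  have "(f has_derivative D) (at (x + 0 *\<^sub>R (w - x)))" using D by simp
  then have "(g has_derivative (\<lambda>t. D (t *\<^sub>R (w - x)))) (at 0)"
    unfolding g_def by (rule has_derivative_compose[rotated]) (auto intro!: derivative_eq_intros)
  moreover have "(\<lambda>t. D (t *\<^sub>R (w - x))) = (*) (D (w - x))"
    using has_derivative_linear[OF D] by (auto simp: linear_cmul)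
  ultimately have "DERIV g 0 :> D (w - x)"
    by (simp add: has_field_derivative_def)
  from DERIV_pos_inc_right[OF this pos]
  obtain d where d: "d > 0" "\<And>h. h > 0 \<Longrightarrow> h < d \<Longrightarrow> g 0 < g h" by auto
  \<comment> \<open>Below \<open>d\<close>, so that \<open>g\<close> has strictly increased; at most
    1, so that the point is a convex combination of \<open>x\<close> and \<open>w\<close>.\<close>
  define h where "h = min (d / 2) 1"
  have h: "0 < h" "h < d" "h \<le> 1" using d(1) by (auto simp: h_def)
  have "(1 - h) *\<^sub>R x + h *\<^sub>R w \<in> sublevel_set f x"
    using h W by (intro convexD) (auto simp: sublevel_set_def)
  then have "g h \<le> g 0"
    by (simp add: g_def sublevel_set_def algebra_simps)
  with d(2) h show False by force
qed

lemma locally_strictly_convex_less_on_tangent: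
  fixes f :: "'a::euclidean_space \<Rightarrow> real"
  assumes D: "(f has_derivative D) (at x)" and e: "D e \<noteq> 0"
    and W: "convex (sublevel_set f x)" "locally_strictly_convex_at (sublevel_set f x) x"
    and y: "D (y - x) = 0" "y \<noteq> x"
  shows "f x < f y"
proof (rule ccontr)
  assume "\<not> f x < f y"
  then have yW: "y \<in> sublevel_set f x" by (simp add: sublevel_set_def)
  have lin: "linear D" using D by (rule has_derivative_linear)
  obtain U where U: "open U" "x \<in> U"
      "\<And>z. z \<in> sublevel_set f x \<inter> U \<Longrightarrow> z \<noteq> x \<Longrightarrow> open_segment x z \<subseteq> interior (sublevel_set f x)"
    using W(2) unfolding locally_strictly_convex_at_def by blast
  obtain r where r: "r > 0" "ball x r \<subseteq> U" using U openE by blast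
  \<comment> \<open>The bound 1 keeps \<open>z\<close> on the segment from \<open>x\<close> to
    \<open>y\<close>; the factor 2 puts \<open>z\<close> strictly inside \<open>ball x r\<close>,
    where local strict convexity applies.\<close>
  define t where "t = min 1 (r / (2 * norm (y - x)))"
  have t: "0 < t" "t \<le> 1" using r y by (auto simp: t_def)
  have "t * norm (y - x) \<le> r / (2 * norm (y - x)) * norm (y - x)"
    unfolding t_def by (intro mult_right_mono) auto
  then have tr: "t * norm (y - x) < r" using r y by simp
  define z where "z = x + t *\<^sub>R (y - x)"
  have "z = (1 - t) *\<^sub>R x + t *\<^sub>R y" by (simp add: z_def algebra_simps)
  then have "z \<in> sublevel_set f x"
    using convexD[OF W(1), of x y "1 - t" t] t yW by (simp add: sublevel_set_def)
  moreover have "z \<in> U" using r tr t by (auto simp: z_def dist_norm subset_iff)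
  moreover have zx: "z \<noteq> x" using t y by (simp add: z_def)
  moreover have "midpoint x z \<in> open_segment x z" using zx by simp
  ultimately have "midpoint x z \<in> interior (sublevel_set f x)" using U(3) by blast
  then obtain s where s: "s > 0" "ball (midpoint x z) s \<subseteq> sublevel_set f x"
    by (auto simp: mem_interior)
  have Dmid: "D (midpoint x z - x) = 0"
  proof -
    have "midpoint x z - x = (t / 2) *\<^sub>R (y - x)"
      by (simp add: midpoint_def z_def scaleR_add_right algebra_simps flip: scaleR_add_left)
    then show ?thesis using y lin by (simp add: linear_cmul)
  qed
  \<comment> \<open>The sign makes \<open>c *\<^sub>R e\<close> a direction of ascent, and its
    length \<open>s / 2\<close> keeps the shifted midpoint in the ball inside the sublevel
    set.\<close>
  define c where "c = sgn (D e) * s / (2 * norm e)"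
  have e0: "e \<noteq> 0" using e linear_0[OF lin] by auto
  have "norm (c *\<^sub>R e) < s"
    using s e e0 by (simp add: c_def abs_mult abs_sgn_eq)
  then have "midpoint x z + c *\<^sub>R e \<in> sublevel_set f x"
    using s by (auto simp: dist_norm subset_iff)
  from derivative_nonpos_on_convex_sublevel[OF D W(1) this]
  have "D ((midpoint x z - x) + c *\<^sub>R e) \<le> 0" by (simp add: algebra_simps)
  then have "c * D e \<le> 0" using Dmid lin by (simp add: linear_add linear_cmul)
  moreover have "c * D e = \<bar>D e\<bar> * s / (2 * norm e)"
    by (simp add: c_def abs_sgn)
  moreover have "\<bar>D e\<bar> * s / (2 * norm e) > 0" using e e0 s by simp
  ultimately show False by simp
qed

text \<open>The Riesz representative of \<open>D\<close> is \<open>adjoint D 1\<close>; uniqueness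
  of the derivative makes it the only candidate for the \<open>THE\<close> in
  \<open>gradient\<close>.\<close>

lemma gradient_inner:
  fixes f :: "'a::euclidean_space \<Rightarrow> real"
  assumes D: "(f has_derivative D) (at x)"
  shows "gradient f x \<bullet> h = D h"
proof -
  have "linear D" using D by (rule has_derivative_linear)
  then have eq: "h \<bullet> adjoint D 1 = D h" for h by (simp add: adjoint_works)
  then have g: "GDERIV f x :> adjoint D 1"
    using D by (simp add: gderiv_def)
  moreover have "G = adjoint D 1" if "GDERIV f x :> G" for G
  proof -
    have "(\<lambda>h. h \<bullet> G) = D"
      using that D unfolding gderiv_def by (rule has_derivative_unique)
    then show ?thesis using eq by (metis vector_eq_ldot)
  qed
  ultimately have "gradient f x = adjoint D 1"
    unfolding gradient_def by blast
  then show ?thesis using eq by (simp add: inner_commute)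
qed

text \<open>With \<open>p\<close> inserting one player's variable and freezing the others, this
  reads a partial gradient as the restriction of the full derivative to that player's
  directions.\<close>

lemma gradient_compose_inner:
  fixes p :: "'b::euclidean_space \<Rightarrow> 'a::real_normed_vector"
  assumes "(f has_derivative D) (at (p v))" and "(p has_derivative P) (at v)"
  shows "gradient (\<lambda>v. f (p v)) v \<bullet> h = D (P h)"
  using gradient_inner[OF diff_chain_at[OF assms(2,1)], of h] by (simp add: o_def)

lemma unique_minimizerI:
  fixes f :: "'a \<Rightarrow> real"
  assumes "\<And>y. y \<noteq> x \<Longrightarrow> f x < f y"
  shows "unique_minimizer f x"
  using assms unfolding unique_minimizer_def is_arg_min_linorder
  by (metis linorder_not_less order_le_less)

text \<open>For \<open>a \<noteq> 0\<close> the formula solves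
  \<open>a \<bullet> (v - p) + b \<bullet> (u - q) = 0\<close> for \<open>v\<close>, moving from
  \<open>p\<close> only along \<open>a\<close>.\<close>

lemma affine_map_tangent_strategy:
  fixes a :: "'a::real_inner" and b q :: "'b::real_inner"
  shows "affine_map (\<lambda>u. p - (b \<bullet> (u - q) / (a \<bullet> a)) *\<^sub>R a)"
  unfolding affine_map_def
proof (intro exI conjI allI)
  show "linear (\<lambda>u. - (b \<bullet> u / (a \<bullet> a)) *\<^sub>R a)"
    by (rule linearI) (simp_all add: inner_add_right add_divide_distrib scaleR_left_distrib scaleR_left_diff_distrib)
  show "p - (b \<bullet> (u - q) / (a \<bullet> a)) *\<^sub>R a
      = - (b \<bullet> u / (a \<bullet> a)) *\<^sub>R a + (p + (b \<bullet> q / (a \<bullet> a)) *\<^sub>R a)" for u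
    by (simp add: inner_diff_right diff_divide_distrib scaleR_diff_left)
qed

theorem theorem3p13:
  fixes J1 J2 J3 :: "(real ^ 'm1) \<times> (real ^ 'm2) \<times> (real ^ 'm3) \<Rightarrow> real"
    and u1d :: "real ^ 'm1" and u2d :: "real ^ 'm2" and u3d :: "real ^ 'm3"
    and \<gamma>1 :: "(real ^ 'm2) \<times> (real ^ 'm3) \<Rightarrow> real ^ 'm1"
  assumes "unique_minimizer J1 (u1d, u2d, u3d)"
    and "convex (sublevel_set J2 (u1d, u2d, u3d))"
    and "locally_strictly_convex_at (sublevel_set J2 (u1d, u2d, u3d)) (u1d, u2d, u3d)"
    and "J2 differentiable (at (u1d, u2d, u3d))"
    and "gradient (\<lambda>u1. J2 (u1, u2d, u3d)) u1d \<noteq> 0"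
    and "affine_map \<gamma>1"
    and "\<gamma>1 (u2d, u3d) = u1d"
    and "\<forall>u2 u3. (\<gamma>1 (u2, u3), u2, u3) \<in> supporting_hyperplane J2 u1d u2d u3d"
    and "convex (sublevel_set (induced_cost J3 \<gamma>1) (u2d, u3d))"
    and "locally_strictly_convex_at (sublevel_set (induced_cost J3 \<gamma>1) (u2d, u3d)) (u2d, u3d)"
    and "induced_cost J3 \<gamma>1 differentiable (at (u2d, u3d))"
    and "gradient (\<lambda>u2. induced_cost J3 \<gamma>1 (u2, u3d)) u2d \<noteq> 0"
  shows "\<exists>\<gamma>2. optimal_reverse_stackelberg J2 J3 u1d u2d u3d \<gamma>1 \<gamma>2"
proof -
  let ?x = "(u1d, u2d, u3d)"
  obtain D where D: "(J2 has_derivative D) (at ?x)"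
    using assms(4) by (auto simp: differentiable_def)
  have linD: "linear D" using D by (rule has_derivative_linear)
  have g1: "gradient (\<lambda>u1. J2 (u1, u2d, u3d)) u1d \<bullet> h = D (h, 0, 0)" for h
    using D by (rule gradient_compose_inner) (auto intro!: derivative_eq_intros simp: zero_prod_def)
  have g2: "gradient (\<lambda>u2. J2 (u1d, u2, u3d)) u2d \<bullet> h = D (0, h, 0)" for h
    using D by (rule gradient_compose_inner) (auto intro!: derivative_eq_intros simp: zero_prod_def)
  have g3: "gradient (\<lambda>u3. J2 (u1d, u2d, u3)) u3d \<bullet> h = D (0, 0, h)" for h
    using D by (rule gradient_compose_inner) (auto intro!: derivative_eq_intros simp: zero_prod_def)
  \<comment> \<open>The leader's partial gradient, padded with zeros, is a direction in which
    \<open>D\<close> does not vanish.\<close>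
  have "gradient (\<lambda>u1. J2 (u1, u2d, u3d)) u1d \<bullet> gradient (\<lambda>u1. J2 (u1, u2d, u3d)) u1d \<noteq> 0"
    using assms(5) by simp
  then obtain e where e: "D e \<noteq> 0" using g1 by auto
  have tangent: "D ((\<gamma>1 (u2, u3), u2, u3) - ?x) = 0" for u2 u3
  proof -
    \<comment> \<open>The three terms of the hyperplane equation are the values of \<open>D\<close>
      on the components of the displacement.\<close>
    have "D (\<gamma>1 (u2, u3) - u1d, 0, 0) + D (0, u2 - u2d, 0) + D (0, 0, u3 - u3d) = 0"
      using assms(8)[rule_format, of u2 u3] by (simp add: supporting_hyperplane_def g1 g2 g3)
    then show ?thesis by (simp add: flip: linear_add[OF linD])
  qed
  have min2: "unique_minimizer (\<lambda>(u2, u3). J2 (\<gamma>1 (u2, u3), u2, u3)) (u2d, u3d)"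
  proof (rule unique_minimizerI)
    fix v assume v: "v \<noteq> (u2d, u3d)"
    obtain u2 u3 where "v = (u2, u3)" by (cases v)
    moreover from this v have "J2 ?x < J2 (\<gamma>1 (u2, u3), u2, u3)"
      by (intro locally_strictly_convex_less_on_tangent[OF D e assms(2,3) tangent]) auto
    ultimately show "(case (u2d, u3d) of (u2, u3) \<Rightarrow> J2 (\<gamma>1 (u2, u3), u2, u3))
        < (case v of (u2, u3) \<Rightarrow> J2 (\<gamma>1 (u2, u3), u2, u3))"
      using assms(7) by simp
  qed

  let ?J = "induced_cost J3 \<gamma>1"
  obtain E where E: "(?J has_derivative E) (at (u2d, u3d))"
    using assms(11) by (auto simp: differentiable_def)
  have linE: "linear E" using E by (rule has_derivative_linear)
  define a where "a = gradient (\<lambda>u2. ?J (u2, u3d)) u2d"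
  define b where "b = gradient (\<lambda>u3. ?J (u2d, u3)) u3d"
  have a: "a \<bullet> h = E (h, 0)" for h
    unfolding a_def using E by (rule gradient_compose_inner) (auto intro!: derivative_eq_intros)
  have b: "b \<bullet> h = E (0, h)" for h
    unfolding b_def using E by (rule gradient_compose_inner) (auto intro!: derivative_eq_intros)
  have aa: "a \<bullet> a \<noteq> 0" using assms(12) by (simp add: a_def)
  then have e': "E (a, 0) \<noteq> 0" by (simp add: a)
  \<comment> \<open>The tangent hyperplane of the induced cost is solved for the middle level
    variable; this is possible because \<open>a \<noteq> 0\<close>.\<close>
  define \<gamma>2 where "\<gamma>2 u3 = u2d - (b \<bullet> (u3 - u3d) / (a \<bullet> a)) *\<^sub>R a" for u3
  have tangent': "E ((\<gamma>2 u3, u3) - (u2d, u3d)) = 0" for u3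
  proof -
    have "E ((\<gamma>2 u3, u3) - (u2d, u3d)) = E (\<gamma>2 u3 - u2d, 0) + E (0, u3 - u3d)"
      by (simp flip: linear_add[OF linE])
    also have "\<dots> = a \<bullet> (\<gamma>2 u3 - u2d) + b \<bullet> (u3 - u3d)" by (simp only: a b)
    also have "\<dots> = 0" using aa by (simp add: \<gamma>2_def del: inner_eq_zero_iff)
    finally show ?thesis .
  qed
  have \<gamma>2d: "\<gamma>2 u3d = u2d" by (simp add: \<gamma>2_def)
  have min3: "unique_minimizer (\<lambda>u3. J3 (\<gamma>1 (\<gamma>2 u3, u3), \<gamma>2 u3, u3)) u3d"
  proof (rule unique_minimizerI)
    fix u3 assume "u3 \<noteq> u3d"
    \<comment> \<open>Distinct follower choices give distinct points on the graph of
      \<open>\<gamma>2\<close>, which lies in the tangent hyperplane.\<close>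
    then have "?J (u2d, u3d) < ?J (\<gamma>2 u3, u3)"
      by (intro locally_strictly_convex_less_on_tangent[OF E e' assms(9,10) tangent']) auto
    then show "J3 (\<gamma>1 (\<gamma>2 u3d, u3d), \<gamma>2 u3d, u3d) < J3 (\<gamma>1 (\<gamma>2 u3, u3), \<gamma>2 u3, u3)"
      by (simp add: induced_cost_def \<gamma>2d)
  qed
  have "affine_map \<gamma>2"
    unfolding \<gamma>2_def by (rule affine_map_tangent_strategy)
  then have "optimal_reverse_stackelberg J2 J3 u1d u2d u3d \<gamma>1 \<gamma>2"
    unfolding optimal_reverse_stackelberg_def
    using assms(6,7) \<gamma>2d min2 min3 by blast
  then show ?thesis by blast
qed

end
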